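(* Let $S_\Delta$ be the collection of all forms of discriminant $\Delta$, and suppose that the class number $h(\Delta)$ is odd. Then there are infinitely many positive integers represented by all forms in $S_\Delta$. In particular, the product of the $x^2$ and $y^2$ coefficients of all the non-principal, non-equivalent forms of discriminant $\Delta$ is represented by all forms in $S_\Delta$; that is, writing the non-principal elements of $S_\Delta$ as the pairs $a_ix^2+b_ixy+c_iy^2$, $a_ix^2-b_ixy+c_iy^2$ for $1\leq i\leq n$, where $h(\Delta)=2n+1$, the integer $\prod_{i=1}^n a_ic_i$ is represented by all forms in $S_\Delta$.
   Context: Conventions: "form" means an integral, binary, positive definite, primitive, reduced quadratic form $Q(x,y)=ax^2+bxy+cy^2$ with $a,b,c\in\mathbb{Z}$. Primitive means $\gcd(a,b,c)=1$; reduced means $|b|\leq a\leq c$, and $b\geq 0$ if $|b|=a$ or $a=c$. The discriminant is $\Delta=b^2-4ac<0$. $Q$ represents an integer $m$ if $Q(x,y)=m$ for some $x,y\in\mathbb{Z}$. The set $S_\Delta$ is finite, with one element for each proper ($\mathrm{SL}_2(\mathbb{Z})$-) equivalence class of primitive positive definite binary quadratic forms of discriminant $\Delta$, and $h(\Delta)=|S_\Delta|$. The principal form is $x^2-\frac{\Delta}{4}y^2$ if $\Delta\equiv 0\pmod 4$ and $x^2+xy+\frac{1-\Delta}{4}y^2$ if $\Delta\equiv 1\pmod 4$. The forms $ax^2+bxy+cy^2$ and $ax^2-bxy+cy^2$ are (improperly) equivalent and are inverse to each other in the class group under Gauss composition; when $h(\Delta)$ is odd, no non-principal class is its own inverse,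 so the non-principal elements of $S_\Delta$ come in such pairs of distinct forms. An empty product is $1$. *)

theory Defs
  imports Main
begin

text \<open>The triple \<open>(a, b, c)\<close> stands for the integral binary quadratic form
  \<open>a x\<^sup>2 + b x y + c y\<^sup>2\<close>.\<close>

type_synonym bqf = "int \<times> int \<times> int"

fun form_val :: "bqf \<Rightarrow> int \<Rightarrow> int \<Rightarrow> int" where
  "form_val (a, b, c) x y = a * x\<^sup>2 + b * x * y + c * y\<^sup>2"

fun discr :: "bqf \<Rightarrow> int" where
  "discr (a, b, c) = b\<^sup>2 - 4 * a * c"

fun primitive_form :: "bqf \<Rightarrow> bool" where
  "primitive_form (a, b, c) \<longleftrightarrow> gcd a (gcd b c) = 1"

definition pos_def_form :: "bqf \<Rightarrow> bool" where
  "pos_def_form Q \<longleftrightarrow> (\<forall>x y. (x, y) \<noteq> (0, 0) \<longrightarrow> form_val Q x y > 0)"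

fun reduced_form :: "bqf \<Rightarrow> bool" where
  "reduced_form (a, b, c) \<longleftrightarrow>
     \<bar>b\<bar> \<le> a \<and> a \<le> c \<and> (\<bar>b\<bar> = a \<or> a = c \<longrightarrow> b \<ge> 0)"

definition represents :: "bqf \<Rightarrow> int \<Rightarrow> bool" where
  "represents Q m \<longleftrightarrow> (\<exists>x y. form_val Q x y = m)"

text \<open>Every proper equivalence class of primitive positive definite forms contains exactly one
  reduced form, so \<open>forms \<Delta>\<close> is a system of representatives of the classes and its cardinality is
  the class number.\<close>

definition forms :: "int \<Rightarrow> bqf set" where
  "forms \<Delta> = {Q. primitive_form Q \<and> pos_def_form Q \<and> reduced_form Q \<and> discr Q = \<Delta>}"

definition class_number :: "int \<Rightarrow> nat" where
  "class_number \<Delta> = card (forms \<Delta>)"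

text \<open>Discriminants are \<open>0\<close> or \<open>1\<close> modulo \<open>4\<close>, so both divisions are exact.\<close>

definition principal_form :: "int \<Rightarrow> bqf" where
  "principal_form \<Delta> =
     (if \<Delta> mod 4 = 0 then (1, 0, - (\<Delta> div 4)) else (1, 1, (1 - \<Delta>) div 4))"

text \<open>The non-principal elements of \<open>forms \<Delta>\<close> are written, each exactly once, as the \<open>n\<close> pairs
  \<open>(a i, \<plusminus> b i, c i)\<close>. No separate distinctness condition is needed: as the principal form lies
  in \<open>forms \<Delta>\<close> whenever this set is nonempty, the condition
  \<open>class_number \<Delta> = 2 * n + 1\<close> forces the \<open>2 * n\<close> listed forms to be pairwise distinct.\<close>

definition inverse_pairing ::
  "int \<Rightarrow> nat \<Rightarrow> (nat \<Rightarrow> int) \<Rightarrow> (nat \<Rightarrow> int) \<Rightarrow> (nat \<Rightarrow> int) \<Rightarrow> bool" where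
  "inverse_pairing \<Delta> n a b c \<longleftrightarrow>
     class_number \<Delta> = 2 * n + 1 \<and>
     forms \<Delta> - {principal_form \<Delta>} = (\<Union>i\<in>{1..n}. {(a i, b i, c i), (a i, - b i, c i)})"

end

theory Submission
  imports Defs Complex_Main "HOL-Computational_Algebra.Primes"
begin

text \<open>
  The class group enters through a symmetric relation instead of a group operation. Three forms
  have \<^emph>\<open>trivial product\<close> if they are properly equivalent to
  \<open>(a1, B, a2 a3)\<close>, \<open>(a2, B, a1 a3)\<close> and \<open>(a3, B, a1 a2)\<close> for common \<open>a1, a2, a3, B\<close>;
  this is Dirichlet composition, written so that the product of the three classes is \<open>1\<close>. Dirichlet's
  composition identity shows that the third form represents \<open>m n\<close> whenever the first two represent
  \<open>m\<close> and \<open>n\<close> (\<open>trivial_product_represents\<close>).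

  Two members of such a triple, of the same discriminant, can be prescribed (\<open>trivial_product_exists\<close>), and they determine
  the class of the remaining one (\<open>trivial_product_unique\<close>). Hence, for a fixed form \<open>h\<close>, sending
  \<open>f\<close> to the reduced \<open>g\<close> that completes the triple \<open>f, g, h\<close> is an involution on the reduced forms.
  An involution on a set of odd size has a fixed point, so every \<open>h\<close> has an \<open>f\<close> with
  \<open>f\<^sup>2 h = 1\<close> (\<open>exists_square_root\<close>). Choosing such an \<open>f\<close> for each \<open>h\<close> is injective, hence
  bijective by finiteness, and \<open>f\<close> is unique (\<open>square_root_unique\<close>). Neither
  step uses associativity.

  Uniqueness for \<open>h\<close> principal says that only the principal class is its own inverse. So
  \<open>(a, b, c)\<close> and \<open>(a, -b, c)\<close> are distinct reduced forms unless they are principal, which gives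
  the pairing. Each \<open>a\<^sub>i c\<^sub>i\<close> is represented by the principal form, as a value of \<open>Q\<^sub>i Q\<^sub>i\<^sup>-\<^sup>1\<close>. A
  non-principal \<open>Q\<close> satisfies \<open>E\<^sup>2 Q = 1\<close> for a non-principal \<open>E\<close>, which is
  \<open>(a\<^sub>j, \<plusminus> b\<^sub>j, c\<^sub>j)\<close> for some \<open>j\<close>; since \<open>E\<close> represents \<open>a\<^sub>j\<close> and \<open>c\<^sub>j\<close>, \<open>Q\<close> represents
  \<open>a\<^sub>j c\<^sub>j\<close>. The other factors are values of the principal form, and multiplying by
  them preserves representability by \<open>Q\<close>. Multiplying the full product by squares
  gives infinitely many common values.
\<close>

section \<open>Proper equivalence\<close>

text \<open>Equality of values, rather than of transformed coefficients, makes the equivalence laws and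
  the invariance of the represented values immediate.\<close>

definition properly_equiv :: "bqf \<Rightarrow> bqf \<Rightarrow> bool" (infix "\<approx>" 50) where
  "f \<approx> g \<longleftrightarrow> (\<exists>p q r s. p * s - q * r = 1 \<and>
     (\<forall>x y. form_val g x y = form_val f (p * x + q * y) (r * x + s * y)))"

lemma properly_equivI:
  assumes "p * s - q * r = 1"
    and "\<And>x y. form_val g x y = form_val f (p * x + q * y) (r * x + s * y)"
  shows "f \<approx> g"
  using assms unfolding properly_equiv_def by blast

lemma properly_equiv_refl [simp]: "f \<approx> f"
  by (rule properly_equivI[of 1 1 0 0]) simp_all

lemma properly_equiv_sym:
  assumes "f \<approx> g"
  shows "g \<approx> f"
proof -
  obtain p q r s where det: "p * s - q * r = 1"
    and eq: "\<And>x y. form_val g x y = form_val f (p * x + q * y) (r * x + s * y)"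
    using assms unfolding properly_equiv_def by blast
  show ?thesis
  proof (rule properly_equivI[of s p "-q" "-r"])
    show "s * p - - q * - r = 1" using det by (simp add: algebra_simps)
    fix x y
    have "p * (s * x + - q * y) + q * (- r * x + p * y) = (p * s - q * r) * x"
      by (simp add: algebra_simps)
    moreover have "r * (s * x + - q * y) + s * (- r * x + p * y) = (p * s - q * r) * y"
      by (simp add: algebra_simps)
    ultimately show "form_val f x y = form_val g (s * x + - q * y) (- r * x + p * y)"
      by (simp add: eq det)
  qed
qed

lemma properly_equiv_trans:
  assumes "f \<approx> g" "g \<approx> h"
  shows "f \<approx> h"
proof -
  obtain p q r s where det: "p * s - q * r = 1"
    and eq: "\<And>x y. form_val g x y = form_val f (p * x + q * y) (r * x + s * y)"
    using assms unfolding properly_equiv_def by blast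
  obtain p' q' r' s' where det': "p' * s' - q' * r' = 1"
    and eq': "\<And>x y. form_val h x y = form_val g (p' * x + q' * y) (r' * x + s' * y)"
    using assms unfolding properly_equiv_def by blast
  show ?thesis
  proof (rule properly_equivI)
    have "(p * p' + q * r') * (r * q' + s * s') - (p * q' + q * s') * (r * p' + s * r')
        = (p * s - q * r) * (p' * s' - q' * r')"
      by (simp add: algebra_simps)
    thus "(p * p' + q * r') * (r * q' + s * s') - (p * q' + q * s') * (r * p' + s * r') = 1"
      by (simp add: det det')
    show "form_val h x y = form_val f ((p * p' + q * r') * x + (p * q' + q * s') * y)
        ((r * p' + s * r') * x + (r * q' + s * s') * y)" for x y
      by (simp add: eq eq' algebra_simps)
  qed
qed

lemma properly_equiv_coeffs:
  assumes "(a, b, c) \<approx> (a', b', c')"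
  obtains p q r s where "p * s - q * r = 1"
    "a' = a * p\<^sup>2 + b * p * r + c * r\<^sup>2"
    "b' = 2 * a * p * q + b * (p * s + q * r) + 2 * c * r * s"
    "c' = a * q\<^sup>2 + b * q * s + c * s\<^sup>2"
proof -
  obtain p q r s where det: "p * s - q * r = 1"
    and eq: "\<And>x y. form_val (a', b', c') x y = form_val (a, b, c) (p * x + q * y) (r * x + s * y)"
    using assms unfolding properly_equiv_def by blast
  have 1: "a' = a * p\<^sup>2 + b * p * r + c * r\<^sup>2" using eq[of 1 0] by simp
  have 2: "c' = a * q\<^sup>2 + b * q * s + c * s\<^sup>2" using eq[of 0 1] by simp
  have "a' + b' + c' = a * (p + q)\<^sup>2 + b * (p + q) * (r + s) + c * (r + s)\<^sup>2"
    using eq[of 1 1] by simp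
  with 1 2 have "b' = 2 * a * p * q + b * (p * s + q * r) + 2 * c * r * s"
    by (simp add: power2_eq_square algebra_simps)
  with det 1 2 show ?thesis using that by blast
qed

lemma properly_equiv_matrix:
  assumes "p * s - q * r = 1"
  shows "(a, b, c) \<approx> (a * p\<^sup>2 + b * p * r + c * r\<^sup>2,
    2 * a * p * q + b * (p * s + q * r) + 2 * c * r * s, a * q\<^sup>2 + b * q * s + c * s\<^sup>2)"
  by (rule properly_equivI[OF assms]) (simp add: power2_eq_square algebra_simps)

lemma properly_equiv_translate: "(a, b, c) \<approx> (a, b + 2 * a * k, a * k\<^sup>2 + b * k + c)"
proof (rule properly_equivI[of 1 1 k 0])
  fix x y
  show "form_val (a, b + 2 * a * k, a * k\<^sup>2 + b * k + c) x y
      = form_val (a, b, c) (1 * x + k * y) (0 * x + 1 * y)"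
    unfolding form_val.simps by algebra
qed simp

lemma properly_equiv_swap: "(a, b, c) \<approx> (c, - b, a)"
  using properly_equiv_matrix[of 0 0 "-1" 1 a b c] by simp

lemma properly_equiv_discr:
  assumes "f \<approx> g"
  shows "discr g = discr f"
proof -
  obtain a b c a' b' c' where f: "f = (a, b, c)" and g: "g = (a', b', c')"
    by (metis prod_cases3)
  obtain p q r s where det: "p * s - q * r = 1" and
    c: "a' = a * p\<^sup>2 + b * p * r + c * r\<^sup>2"
    "b' = 2 * a * p * q + b * (p * s + q * r) + 2 * c * r * s"
    "c' = a * q\<^sup>2 + b * q * s + c * s\<^sup>2"
    using properly_equiv_coeffs[OF assms[unfolded f g]] .
  have "b'\<^sup>2 - 4 * a' * c' = (p * s - q * r)\<^sup>2 * (b\<^sup>2 - 4 * a * c)"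
    unfolding c by (simp add: power2_eq_square algebra_simps)
  thus ?thesis by (simp add: f g det)
qed

text \<open>Primes, rather than the nested gcd, are what the divisibility arguments below work with. The
  prime \<open>2\<close> covers the degenerate form \<open>(0, 0, 0)\<close>.\<close>

lemma primitive_form_iff:
  "primitive_form (a, b, c) \<longleftrightarrow> (\<forall>p. prime p \<longrightarrow> \<not> (p dvd a \<and> p dvd b \<and> p dvd c))"
proof
  assume "primitive_form (a, b, c)"
  thus "\<forall>p. prime p \<longrightarrow> \<not> (p dvd a \<and> p dvd b \<and> p dvd c)"
    by (metis gcd_greatest primitive_form.simps not_prime_unit)
next
  assume *: "\<forall>p. prime p \<longrightarrow> \<not> (p dvd a \<and> p dvd b \<and> p dvd c)"
  show "primitive_form (a, b, c)"
  proof (rule ccontr)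
    assume "\<not> ?thesis"
    hence nu: "\<not> is_unit (gcd a (gcd b c))" by simp
    have "prime (2 :: int)" by simp
    hence "gcd a (gcd b c) \<noteq> 0" using * by (metis dvd_0_right gcd_eq_0_iff)
    then obtain p where "prime p" "p dvd gcd a (gcd b c)"
      using nu prime_divisorE by blast
    with * show False by (meson dvd_trans gcd_dvd1 gcd_dvd2)
  qed
qed

lemma properly_equiv_primitive:
  assumes "f \<approx> g" "primitive_form f"
  shows "primitive_form g"
proof -
  obtain a b c a' b' c' where f: "f = (a, b, c)" and g: "g = (a', b', c')"
    by (metis prod_cases3)
  obtain p q r s where
    "a = a' * p\<^sup>2 + b' * p * r + c' * r\<^sup>2"
    "b = 2 * a' * p * q + b' * (p * s + q * r) + 2 * c' * r * s"
    "c = a' * q\<^sup>2 + b' * q * s + c' * s\<^sup>2"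
    using properly_equiv_coeffs[OF properly_equiv_sym[OF assms(1)[unfolded f g]]] .
  hence "d dvd a \<and> d dvd b \<and> d dvd c" if "d dvd a'" "d dvd b'" "d dvd c'" for d
    using that by (auto intro!: dvd_add simp: dvd_mult dvd_mult2)
  thus ?thesis using assms(2) unfolding f g primitive_form_iff by blast
qed

text \<open>Completing the square: \<open>4 a f(x, y) = (2 a x + b y)\<^sup>2 - discr f y\<^sup>2\<close>.\<close>

lemma pos_def_form_iff:
  assumes "discr (a, b, c) < 0"
  shows "pos_def_form (a, b, c) \<longleftrightarrow> a > 0"
proof
  assume "pos_def_form (a, b, c)"
  from this[unfolded pos_def_form_def, rule_format, of 1 0] show "a > 0" by simp
next
  assume a: "a > 0"
  show "pos_def_form (a, b, c)" unfolding pos_def_form_def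
  proof (intro allI impI)
    fix x y :: int assume xy: "(x, y) \<noteq> (0, 0)"
    have id: "4 * a * form_val (a, b, c) x y = (2 * a * x + b * y)\<^sup>2 + - discr (a, b, c) * y\<^sup>2"
      by (simp add: power2_eq_square algebra_simps)
    have "(2 * a * x + b * y)\<^sup>2 + - discr (a, b, c) * y\<^sup>2 > 0"
    proof (cases "y = 0")
      case True
      thus ?thesis using xy a by simp
    next
      case False
      hence "- discr (a, b, c) * y\<^sup>2 > 0" using assms by (intro mult_pos_pos) simp_all
      thus ?thesis by (smt (verit) zero_le_power2)
    qed
    hence "4 * a * form_val (a, b, c) x y > 0" unfolding id .
    with a show "form_val (a, b, c) x y > 0" by (simp add: zero_less_mult_iff del: form_val.simps)
  qed
qed

lemma properly_equiv_represents:
  assumes "f \<approx> g"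
  shows "represents g m \<longleftrightarrow> represents f m"
proof -
  have "represents f m" if "f \<approx> g" "represents g m" for f g
    using that unfolding properly_equiv_def represents_def by metis
  thus ?thesis using assms properly_equiv_sym by blast
qed

lemma properly_equiv_pos_def:
  assumes "f \<approx> g" "pos_def_form f"
  shows "pos_def_form g"
proof -
  obtain p q r s where det: "p * s - q * r = 1"
    and eq: "\<And>x y. form_val g x y = form_val f (p * x + q * y) (r * x + s * y)"
    using assms unfolding properly_equiv_def by blast
  have "(p * x + q * y, r * x + s * y) \<noteq> (0, 0)" if "(x, y) \<noteq> (0, 0)" for x y
  proof
    assume "(p * x + q * y, r * x + s * y) = (0, 0)"
    hence *: "p * x + q * y = 0" "r * x + s * y = 0" by simp_all
    have "(p * s - q * r) * x = s * (p * x + q * y) - q * (r * x + s * y)"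
      "(p * s - q * r) * y = p * (r * x + s * y) - r * (p * x + q * y)"
      by (simp_all add: algebra_simps)
    with * det that show False by simp
  qed
  thus ?thesis using assms(2) unfolding pos_def_form_def eq by blast
qed

section \<open>Reduction\<close>

text \<open>Take the least leading coefficient \<open>a\<close> in the class and translate the middle coefficient into
  \<open>(-a, a]\<close>. Swapping the outer coefficients stays in the class, so minimality gives \<open>a \<le> c\<close>;
  if \<open>a = c\<close>, one more swap makes the middle coefficient nonnegative.\<close>

lemma exists_reduced:
  assumes "discr f < 0" "pos_def_form f"
  shows "\<exists>g. reduced_form g \<and> f \<approx> g"
proof -
  define P where "P n \<longleftrightarrow> (\<exists>b c. f \<approx> (int n, b, c))" for n
  have pos: "a > 0" if "f \<approx> (a, b, c)" for a b c
    using that assms properly_equiv_pos_def[OF that] properly_equiv_discr[OF that] pos_def_form_iff[of a b c] by simp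
  obtain a0 b0 c0 where f: "f = (a0, b0, c0)" by (metis prod_cases3)
  have "f \<approx> (int (nat a0), b0, c0)" using pos[of a0 b0 c0] f by simp
  hence ex: "\<exists>n. P n" unfolding P_def by blast
  define n where "n = (LEAST n. P n)"
  have "P n" unfolding n_def using ex by (rule LeastI_ex)
  then obtain b c where abc: "f \<approx> (int n, b, c)" unfolding P_def by blast
  define a where "a = int n"
  have min: "a \<le> a'" if "f \<approx> (a', b', c')" for a' b' c'
  proof -
    have "a' > 0" using pos that .
    hence "P (nat a')" unfolding P_def using that by auto
    hence "n \<le> nat a'" unfolding n_def by (rule Least_le)
    thus ?thesis unfolding a_def using \<open>a' > 0\<close> by linarith
  qed
  have a: "a > 0" using pos abc a_def by blast
  (* b1 is the representative of b modulo 2 a in the half-open interval (-a, a] *)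
  define k where "k = (a - b) div (2 * a)"
  define b1 where "b1 = b + 2 * a * k"
  define c1 where "c1 = a * k\<^sup>2 + b * k + c"
  have eq1: "f \<approx> (a, b1, c1)"
    using properly_equiv_trans[OF abc[folded a_def] properly_equiv_translate[of a b c k]]
    by (simp add: b1_def c1_def)
  have "a - b1 = (a - b) mod (2 * a)"
    unfolding b1_def k_def by (simp add: minus_mult_div_eq_mod[symmetric])
  hence b1: "- a < b1" "b1 \<le> a"
    using pos_mod_bound[of "2 * a" "a - b"] pos_mod_sign[of "2 * a" "a - b"] a by linarith+
  have eq2: "f \<approx> (c1, - b1, a)"
    using properly_equiv_trans[OF eq1 properly_equiv_swap] .
  have "a \<le> c1" using min eq2 .
  show ?thesis
  proof (cases "a = c1 \<and> b1 < 0")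
    case True
    thus ?thesis using eq2 b1 by (intro exI[of _ "(c1, - b1, a)"]) auto
  next
    case False
    thus ?thesis using eq1 b1 \<open>a \<le> c1\<close> by (intro exI[of _ "(a, b1, c1)"]) auto
  qed
qed

text \<open>For \<open>X = \<bar>x\<bar>\<close> and \<open>Y = \<bar>y\<bar>\<close> the value is at least \<open>a X\<^sup>2 - a X Y + c Y\<^sup>2\<close>, because
  \<open>\<bar>b\<bar> \<le> a\<close>. If \<open>X \<ge> Y\<close>, the first two terms together are nonnegative. Otherwise their negative
  \<open>a X (Y - X)\<close> is at most \<open>c X (Y - X)\<close>, and \<open>X\<^sup>2 - X Y + Y\<^sup>2\<close> is a positive integer.\<close>

lemma reduced_form_value_ge:
  assumes "reduced_form (a, b, c)" "y \<noteq> 0"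
  shows "form_val (a, b, c) x y \<ge> c"
proof -
  have r: "\<bar>b\<bar> \<le> a" "a \<le> c" "0 \<le> a" using assms by auto
  define X where "X = \<bar>x\<bar>"
  define Y where "Y = \<bar>y\<bar>"
  have XY: "X \<ge> 0" "Y \<ge> 1" using assms(2) by (auto simp: X_def Y_def)
  have sq: "x\<^sup>2 = X\<^sup>2" "y\<^sup>2 = Y\<^sup>2" by (simp_all add: X_def Y_def)
  have "\<bar>b * x * y\<bar> = \<bar>b\<bar> * (X * Y)" by (simp add: abs_mult X_def Y_def)
  also have "\<dots> \<le> a * (X * Y)" using r XY by (intro mult_right_mono) auto
  finally have low: "form_val (a, b, c) x y \<ge> a * X\<^sup>2 - a * (X * Y) + c * Y\<^sup>2"
    by (simp add: sq)
  have Y2: "Y\<^sup>2 \<ge> 1" using XY by (simp add: one_le_power)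
  have "a * X\<^sup>2 - a * (X * Y) + c * Y\<^sup>2 \<ge> c"
  proof (cases "X \<ge> Y")
    case True
    have "a * X\<^sup>2 - a * (X * Y) = a * X * (X - Y)" by (simp add: power2_eq_square algebra_simps)
    also have "\<dots> \<ge> 0" using True r XY by simp
    finally have "a * X\<^sup>2 - a * (X * Y) \<ge> 0" .
    moreover have "c * Y\<^sup>2 \<ge> c * 1" using Y2 r by (intro mult_left_mono) auto
    ultimately show ?thesis by linarith
  next
    case False
    have "a * (X * (Y - X)) \<le> c * (X * (Y - X))" using False r XY by (intro mult_right_mono) auto
    moreover have "c * (Y\<^sup>2 - X * (Y - X)) \<ge> c * 1"
    proof (rule mult_left_mono)
      have "Y\<^sup>2 - X * (Y - X) = X\<^sup>2 + Y * (Y - X)"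
        by (simp add: power2_eq_square algebra_simps)
      moreover have "Y * (Y - X) \<ge> 1 * 1" using False XY by (intro mult_mono) auto
      ultimately show "1 \<le> Y\<^sup>2 - X * (Y - X)" by (smt (verit) zero_le_power2)
    qed (use r in auto)
    ultimately show ?thesis by (simp add: power2_eq_square algebra_simps)
  qed
  with low show ?thesis by linarith
qed

text \<open>A transformation with lower left entry \<open>r = 0\<close> is, up to sign, a translation, and two middle coefficients in
  \<open>(-a, a]\<close> that are congruent modulo \<open>2 a\<close> agree. If \<open>r \<noteq> 0\<close>, the previous lemma, applied to the
  transformation and to its inverse, forces all outer coefficients to be equal.\<close>

lemma reduced_form_unique:
  assumes "f \<approx> g" "reduced_form f" "reduced_form g" "discr f < 0"
  shows "f = g"
proof -
  obtain a b c a' b' c' where f: "f = (a, b, c)" and g: "g = (a', b', c')"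
    by (metis prod_cases3)
  have d: "b'\<^sup>2 - 4 * a' * c' = b\<^sup>2 - 4 * a * c"
    using properly_equiv_discr[OF assms(1)] by (simp add: f g)
  have red: "\<bar>b\<bar> \<le> a" "a \<le> c" "\<bar>b\<bar> = a \<or> a = c \<longrightarrow> b \<ge> 0"
    "\<bar>b'\<bar> \<le> a'" "a' \<le> c'" "\<bar>b'\<bar> = a' \<or> a' = c' \<longrightarrow> b' \<ge> 0"
    using assms(2,3) by (simp_all add: f g)
  have "a \<noteq> 0"
  proof
    assume "a = 0"
    with assms(4) show False by (simp add: f power2_eq_square mult_less_0_iff)
  qed
  hence a: "a > 0" using red by linarith
  obtain p q r s where det: "p * s - q * r = 1" and
    c: "a' = a * p\<^sup>2 + b * p * r + c * r\<^sup>2"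
    "b' = 2 * a * p * q + b * (p * s + q * r) + 2 * c * r * s"
    "c' = a * q\<^sup>2 + b * q * s + c * s\<^sup>2"
    using properly_equiv_coeffs[OF assms(1)[unfolded f g]] .
  show ?thesis
  proof (cases "r = 0")
    case True
    with det have ps: "p * s = 1" by simp
    hence "p = 1 \<and> s = 1 \<or> p = -1 \<and> s = -1" by (rule zmult_eq_1_iff[THEN iffD1])
    hence p2: "p\<^sup>2 = 1" by auto
    have aa: "a' = a" using c(1) True p2 by simp
    have bb: "b' = b + 2 * a * (p * q)" using c(2) True ps by (simp add: algebra_simps)
    define k where "k = p * q"
    have bd: "- a < b" "b \<le> a" "- a < b'" "b' \<le> a" using red aa a by linarith+
    have "k = 0"
    proof (rule ccontr)
      assume "k \<noteq> 0"
      hence "k \<ge> 1 \<or> k \<le> -1" by linarith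
      hence "a * k \<ge> a * 1 \<or> a * k \<le> a * -1" using a by (meson less_imp_le mult_left_mono)
      moreover have "b' = b + 2 * (a * k)" using bb k_def by simp
      ultimately show False using bd by linarith
    qed
    hence "b' = b" using bb k_def by simp
    with d aa a have "c' = c" by simp
    with \<open>b' = b\<close> aa show ?thesis by (simp add: f g)
  next
    case False
    (* each leading coefficient is a value of the other form with nonzero second argument *)
    have "form_val (a, b, c) p r \<ge> c"
      using reduced_form_value_ge assms(2) False by (simp add: f del: form_val.simps)
    hence 1: "a' \<ge> c" using c by simp
    have "form_val (a', b', c') s (- r) = a * (p * s - q * r)\<^sup>2"
      unfolding c by (simp add: power2_eq_square algebra_simps)
    hence "form_val (a', b', c') s (- r) = a" by (simp add: det)
    moreover have "form_val (a', b', c') s (- r) \<ge> c'"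
      using reduced_form_value_ge assms(3) False by (simp add: g del: form_val.simps)
    ultimately have "a \<ge> c'" by simp
    hence e: "c = a" "a' = a" "c' = a" using 1 red by linarith+
    hence "b \<ge> 0" "b' \<ge> 0" "b'\<^sup>2 = b\<^sup>2" using red d by auto
    hence "b' = b" by (simp add: power2_eq_iff_nonneg)
    with e show ?thesis by (simp add: f g)
  qed
qed

text \<open>The condition of \<open>forms\<close> without reducedness and with the discriminant left open: it is invariant
  under proper equivalence.\<close>

definition admissible :: "bqf \<Rightarrow> bool" where
  "admissible f \<longleftrightarrow> primitive_form f \<and> pos_def_form f \<and> discr f < 0"

lemma admissible_leading_pos: "admissible (a, b, c) \<Longrightarrow> a > 0"
  unfolding admissible_def using pos_def_form_iff by blast

lemma properly_equiv_admissible: "f \<approx> g \<Longrightarrow> admissible f \<Longrightarrow> admissible g"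
  unfolding admissible_def
  using properly_equiv_primitive properly_equiv_pos_def properly_equiv_discr by metis

section \<open>Forms as lattices in the complex plane\<close>

text \<open>The form \<open>(a, b, c)\<close> of discriminant \<open>\<Delta> < 0\<close> corresponds to the ideal
  \<open>\<int> a + \<int> (b + \<surd>\<Delta>) / 2\<close> of the imaginary quadratic order of discriminant \<open>\<Delta>\<close>. Proper
  equivalence of forms becomes similarity of lattices, and similarity is visibly
  compatible with the lattice operations that prove uniqueness of composition.\<close>

definition form_root :: "bqf \<Rightarrow> complex" where
  "form_root f = Complex (of_int (fst (snd f)) / 2) (sqrt (- of_int (discr f)) / 2)"

definition form_lattice :: "bqf \<Rightarrow> complex set" where
  "form_lattice f = {of_int (fst f) * of_int x + form_root f * of_int y | x y. True}"

lemma form_lattice_iff: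
  "z \<in> form_lattice (a, b, c) \<longleftrightarrow>
    (\<exists>x y. z = of_int a * of_int x + form_root (a, b, c) * of_int y)"
  by (simp add: form_lattice_def)

lemma form_root_add_cnj: "form_root (a, b, c) + cnj (form_root (a, b, c)) = of_int b"
  by (simp add: form_root_def complex_eq_iff)

lemma form_root_mult_cnj:
  assumes "discr (a, b, c) < 0"
  shows "form_root (a, b, c) * cnj (form_root (a, b, c)) = of_int a * of_int c"
proof -
  have "(sqrt (- of_int (discr (a, b, c))))\<^sup>2 = - of_int (discr (a, b, c))"
    using assms by (intro real_sqrt_pow2) (simp del: discr.simps)
  hence "sqrt (- of_int (discr (a, b, c))) * sqrt (- of_int (discr (a, b, c)))
      = 4 * (of_int a * of_int c) - of_int b * of_int b"
    by (simp add: power2_eq_square)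
  thus ?thesis
    by (simp add: form_root_def complex_eq_iff field_simps del: discr.simps)
qed

lemma form_root_indep:
  assumes "discr f < 0" "of_int u + form_root f * of_int v = 0"
  shows "u = 0" "v = 0"
proof -
  have "Im (of_int u + form_root f * of_int v) = 0" using assms(2) by simp
  hence "sqrt (- of_int (discr f)) * of_int v = 0" by (simp add: form_root_def)
  thus "v = 0" using assms(1) by simp
  thus "u = 0" using assms(2) by simp
qed

lemma form_root_nonzero:
  assumes "discr f < 0"
  shows "form_root f \<noteq> 0"
  using form_root_indep(2)[OF assms, of 0 1] by auto

text \<open>The form is the norm on its lattice, divided by \<open>a\<close>.\<close>

lemma lattice_norm:
  assumes "discr (a, b, c) < 0"
  shows "(of_int a * of_int x + form_root (a, b, c) * of_int y)
    * cnj (of_int a * of_int x + form_root (a, b, c) * of_int y)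
    = of_int (a * form_val (a, b, c) x y)"
proof -
  define w where "w = form_root (a, b, c)"
  have *: "w * cnj w = of_int a * of_int c" "w + cnj w = of_int b"
    using form_root_mult_cnj[OF assms] form_root_add_cnj[of a b c] by (simp_all add: w_def)
  have "(of_int a * of_int x + w * of_int y) * cnj (of_int a * of_int x + w * of_int y)
    = of_int a * of_int a * (of_int x)\<^sup>2 + of_int a * of_int x * of_int y * (w + cnj w)
      + (w * cnj w) * (of_int y)\<^sup>2"
    by (simp add: power2_eq_square algebra_simps)
  thus ?thesis unfolding w_def[symmetric] * by (simp add: power2_eq_square algebra_simps)
qed

text \<open>The transformation that takes \<open>f\<close> to \<open>g\<close> takes the basis \<open>a, w\<close> of the lattice of \<open>f\<close> to another
  basis \<open>u, v\<close> of it. Because \<open>cnj u * v = a * w'\<close> and \<open>cnj u * u = a * a'\<close>, multiplication by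
  \<open>a' / u\<close> takes this basis to the basis \<open>a', w'\<close> of the lattice of \<open>g\<close>.\<close>

lemma properly_equiv_imp_similar:
  assumes "f \<approx> g" "admissible f"
  shows "\<exists>l. l \<noteq> 0 \<and> form_lattice g = (*) l ` form_lattice f"
proof -
  obtain a b c a' b' c' where f: "f = (a, b, c)" and g: "g = (a', b', c')"
    by (metis prod_cases3)
  obtain p q r s where det: "p * s - q * r = 1" and
    co: "a' = a * p\<^sup>2 + b * p * r + c * r\<^sup>2"
    "b' = 2 * a * p * q + b * (p * s + q * r) + 2 * c * r * s"
    "c' = a * q\<^sup>2 + b * q * s + c * s\<^sup>2"
    using properly_equiv_coeffs[OF assms(1)[unfolded f g]] .
  have df: "discr f < 0" using assms(2) by (simp add: admissible_def)
  have dg: "discr g = discr f" using properly_equiv_discr[OF assms(1)] .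
  have pos: "a > 0" "a' > 0"
    using admissible_leading_pos assms properly_equiv_admissible[OF assms] unfolding f g by blast+
  define w where "w = form_root f"
  define w' where "w' = form_root g"
  have sum: "w + cnj w = of_int b" and prod: "w * cnj w = of_int a * of_int c"
    using form_root_mult_cnj df form_root_add_cnj unfolding w_def f by blast+
  define u where "u = of_int a * of_int p + w * of_int r"
  define v where "v = of_int a * of_int q + w * of_int s"
  have uu: "u * cnj u = of_int (a * a')"
    using lattice_norm[of a b c p r] df co(1) by (simp add: u_def w_def f)
  hence u0: "u \<noteq> 0" using pos by auto
  have uv: "cnj u * v = of_int a * w'"
  proof -
    have "cnj u * v = of_int a * of_int a * of_int p * of_int q
        + of_int a * of_int p * of_int s * w + of_int a * of_int q * of_int r * cnj w
        + of_int r * of_int s * (w * cnj w)"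
      by (simp add: u_def v_def algebra_simps)
    also have "\<dots> = of_int a * (of_int a * of_int p * of_int q
        + of_int p * of_int s * w + of_int q * of_int r * cnj w
        + of_int r * of_int s * of_int c)"
      unfolding prod by (simp add: algebra_simps)
    also have "of_int a * of_int p * of_int q
        + of_int p * of_int s * w + of_int q * of_int r * cnj w
        + of_int r * of_int s * of_int c = w'"
    proof (rule complex_eqI)
      show "Re (of_int a * of_int p * of_int q
        + of_int p * of_int s * w + of_int q * of_int r * cnj w
        + of_int r * of_int s * of_int c) = Re w'"
        by (simp add: w_def w'_def form_root_def f g co field_simps)
      have "real_of_int p * real_of_int s - real_of_int q * real_of_int r = 1"
        using det by (metis of_int_1 of_int_diff of_int_mult)
      hence "Im w * (real_of_int p * real_of_int s - real_of_int q * real_of_int r) = Im w" by simp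
      moreover have "Im w' = Im w" using dg by (simp add: w_def w'_def form_root_def)
      ultimately show "Im (of_int a * of_int p * of_int q
        + of_int p * of_int s * w + of_int q * of_int r * cnj w
        + of_int r * of_int s * of_int c) = Im w'"
        by (simp add: algebra_simps)
    qed
    finally show ?thesis .
  qed
  define l where "l = of_int a' / u"
  have lu: "l * u = of_int a'" using u0 by (simp add: l_def)
  have lv: "l * v = w'"
  proof -
    have "(u * cnj u) * v = u * (of_int a * w')" using uv by (simp add: mult.assoc)
    hence "of_int a * (of_int a' * v) = of_int a * (u * w')" unfolding uu by (simp add: algebra_simps)
    hence "of_int a' * v = u * w'" using pos by simp
    thus ?thesis using u0 by (simp add: l_def field_simps)
  qed
  have comb: "of_int a' * of_int x + w' * of_int y
      = l * (of_int a * of_int (p * x + q * y) + w * of_int (r * x + s * y))" for x y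
    unfolding lu[symmetric] lv[symmetric] by (simp add: u_def v_def algebra_simps)
  have "form_lattice g = (*) l ` form_lattice f"
  proof (intro set_eqI iffI)
    fix z assume "z \<in> form_lattice g"
    then obtain x y where "z = of_int a' * of_int x + w' * of_int y"
      by (auto simp: form_lattice_iff g w'_def)
    hence "z = l * (of_int a * of_int (p * x + q * y) + w * of_int (r * x + s * y))"
      using comb by simp
    moreover have "of_int a * of_int (p * x + q * y) + w * of_int (r * x + s * y) \<in> form_lattice f"
      unfolding f w_def form_lattice_iff by blast
    ultimately show "z \<in> (*) l ` form_lattice f" by blast
  next
    fix z assume "z \<in> (*) l ` form_lattice f"
    then obtain t where t: "t \<in> form_lattice f" "z = l * t" by blast
    then obtain x y where z: "z = l * (of_int a * of_int x + w * of_int y)"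
      unfolding f w_def form_lattice_iff by blast
    have "p * (s * x - q * y) + q * (p * y - r * x) = (p * s - q * r) * x"
      "r * (s * x - q * y) + s * (p * y - r * x) = (p * s - q * r) * y"
      by (simp_all add: algebra_simps)
    hence "z = of_int a' * of_int (s * x - q * y) + w' * of_int (p * y - r * x)"
      unfolding comb z det by simp
    thus "z \<in> form_lattice g" unfolding form_lattice_iff g w'_def by blast
  qed
  moreover have "l \<noteq> 0" using lu pos by auto
  ultimately show ?thesis by blast
qed

text \<open>A similarity provides integer matrices in both directions that are inverse to each other, so the
  determinant is a unit; it is \<open>1\<close> because multiplication by \<open>l\<close> preserves orientation. Equal
  discriminants mean equal imaginary parts of the roots, which fixes \<open>a' = \<bar>l\<bar>\<^sup>2 a\<close>. Comparing
  norms then gives the equality of values.\<close>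

lemma similar_imp_properly_equiv:
  assumes "admissible f" "admissible g" "discr g = discr f"
    and "form_lattice g = (*) l ` form_lattice f" "l \<noteq> 0"
  shows "f \<approx> g"
proof -
  obtain a b c a' b' c' where f: "f = (a, b, c)" and g: "g = (a', b', c')"
    by (metis prod_cases3)
  have df: "discr f < 0" "discr g < 0" using assms by (simp_all add: admissible_def)
  have pos: "a > 0" "a' > 0"
    using admissible_leading_pos assms unfolding f g by blast+
  define w where "w = form_root f"
  define w' where "w' = form_root g"
  have Lf: "z \<in> form_lattice f \<longleftrightarrow> (\<exists>x y. z = of_int a * of_int x + w * of_int y)" for z
    by (simp add: form_lattice_iff f w_def)
  have Lg: "z \<in> form_lattice g \<longleftrightarrow> (\<exists>x y. z = of_int a' * of_int x + w' * of_int y)" for z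
    by (simp add: form_lattice_iff g w'_def)
  have in_f: "\<exists>x y. z = l * (of_int a * of_int x + w * of_int y)" if "z \<in> form_lattice g" for z
    using that unfolding assms(4) using Lf by auto
  have in_g: "\<exists>x y. l * z = of_int a' * of_int x + w' * of_int y" if "z \<in> form_lattice f" for z
    using that Lg unfolding assms(4) by auto
  have "of_int a' = of_int a' * of_int 1 + w' * of_int 0" by simp
  hence "of_int a' \<in> form_lattice g" using Lg by blast
  then obtain p r where u: "of_int a' = l * (of_int a * of_int p + w * of_int r)" using in_f by blast
  have "w' = of_int a' * of_int 0 + w' * of_int 1" by simp
  hence "w' \<in> form_lattice g" using Lg by blast
  then obtain q s where v: "w' = l * (of_int a * of_int q + w * of_int s)" using in_f by blast
  have "of_int a = of_int a * of_int 1 + w * of_int 0" by simp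
  hence "of_int a \<in> form_lattice f" using Lf by blast
  then obtain p' r' where u': "l * of_int a = of_int a' * of_int p' + w' * of_int r'"
    using in_g by blast
  have "w = of_int a * of_int 0 + w * of_int 1" by simp
  hence "w \<in> form_lattice f" using Lf by blast
  then obtain q' s' where v': "l * w = of_int a' * of_int q' + w' * of_int s'"
    using in_g by blast
  have "l * (of_int (a * (p * p' + q * r' - 1)) + w * of_int (r * p' + s * r')) = 0"
    using u' unfolding u v by (simp add: algebra_simps)
  hence "of_int (a * (p * p' + q * r' - 1)) + w * of_int (r * p' + s * r') = 0"
    using assms(5) by simp
  from form_root_indep[OF df(1) this[unfolded w_def]] pos
  have n1: "p * p' + q * r' = 1" "r * p' + s * r' = 0" by auto
  have "l * (of_int (a * (p * q' + q * s')) + w * of_int (r * q' + s * s' - 1)) = 0"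
    using v' unfolding u v by (simp add: algebra_simps)
  hence "of_int (a * (p * q' + q * s')) + w * of_int (r * q' + s * s' - 1) = 0"
    using assms(5) by simp
  from form_root_indep[OF df(1) this[unfolded w_def]] pos
  have n2: "p * q' + q * s' = 0" "r * q' + s * s' = 1" by auto
  have "(p * s - q * r) * (p' * s' - q' * r')
      = (p * p' + q * r') * (r * q' + s * s') - (p * q' + q * s') * (r * p' + s * r')"
    by (simp add: algebra_simps)
  hence unit: "(p * s - q * r) * (p' * s' - q' * r') = 1" unfolding n1 n2 by simp
  define N where "N = (cmod l)\<^sup>2"
  have ll: "l * cnj l = of_real N" unfolding N_def by (rule complex_norm_square[symmetric])
  have N: "N > 0" using assms(5) by (simp add: N_def)
  (* in both bases the ratio of the second vector to the first lies in the upper half plane *)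
  have "w' * cnj (of_int a') = (l * cnj l) *
      ((of_int a * of_int q + w * of_int s) * cnj (of_int a * of_int p + w * of_int r))"
    unfolding u v by simp
  hence "Im (w' * cnj (of_int a')) = N *
      Im ((of_int a * of_int q + w * of_int s) * cnj (of_int a * of_int p + w * of_int r))"
    unfolding ll by simp
  also have "Im ((of_int a * of_int q + w * of_int s) * cnj (of_int a * of_int p + w * of_int r))
      = of_int a * Im w * of_int (p * s - q * r)"
    by (simp add: algebra_simps)
  finally have im: "Im w' * of_int a' = N * of_int a * Im w * of_int (p * s - q * r)"
    by simp
  have Im: "Im w > 0" "Im w' > 0" using df by (simp_all add: w_def w'_def form_root_def)
  have "N * of_int a * Im w * of_int (p * s - q * r) > 0"
    unfolding im[symmetric] using Im pos by simp
  moreover have "N * of_int a * Im w > 0" using N pos Im by simp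
  ultimately have "real_of_int (p * s - q * r) > 0" by (simp only: zero_less_mult_pos)
  hence "p * s - q * r > 0" by (simp only: of_int_0_less_iff)
  with unit have det: "p * s - q * r = 1" by (simp add: pos_zmult_eq_1_iff)
  have "Im w' = Im w" using assms(3) by (simp add: w_def w'_def form_root_def)
  hence scale: "of_int a' = N * of_int a" using im Im unfolding det by simp
  show ?thesis
  proof (rule properly_equivI[OF det])
    fix x y
    define X where "X = p * x + q * y"
    define Y where "Y = r * x + s * y"
    have id: "of_int a' * of_int x + w' * of_int y = l * (of_int a * of_int X + w * of_int Y)"
      unfolding u v X_def Y_def by (simp add: algebra_simps)
    have "complex_of_int (a' * form_val g x y)
        = (of_int a' * of_int x + w' * of_int y) * cnj (of_int a' * of_int x + w' * of_int y)"
      using lattice_norm[OF df(2)[unfolded g], of x y] unfolding w'_def g by simp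
    also have "\<dots> = (l * cnj l) *
        ((of_int a * of_int X + w * of_int Y) * cnj (of_int a * of_int X + w * of_int Y))"
      unfolding id by simp
    also have "\<dots> = of_real N * of_int (a * form_val f X Y)"
      using lattice_norm[OF df(1)[unfolded f], of X Y] unfolding ll w_def f by simp
    also have "\<dots> = of_real (N * of_int a) * of_int (form_val f X Y)" by simp
    also have "\<dots> = complex_of_int (a' * form_val f X Y)"
      unfolding scale[symmetric] by simp
    finally have "a' * form_val g x y = a' * form_val f X Y" by (simp only: of_int_eq_iff)
    thus "form_val g x y = form_val f (p * x + q * y) (r * x + s * y)"
      using pos by (simp add: X_def Y_def del: form_val.simps)
  qed
qed

lemma coprime_of_primitive:
  fixes a B c d :: int
  assumes "primitive_form (a, B, d * c)"
  shows "coprime a (gcd B c)"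
proof (rule coprimeI)
  fix k assume "k dvd a" "k dvd gcd B c"
  hence "k dvd gcd a (gcd B (d * c))" by (auto intro: dvd_mult)
  thus "is_unit k" using assms by (simp only: primitive_form.simps)
qed

text \<open>This recovers the lattice of the second form of a triple from the lattices of the first
  and the third: the set below consists of the \<open>z\<close> that multiply the first lattice into the conjugate
  of the third. It is defined without reference to bases, so
  scaling the two given lattices only scales it. The inclusion from left to right is where
  primitivity matters: writing \<open>z\<close> in terms of the roots yields an integer \<open>m\<close> such that \<open>a1\<close>
  divides \<open>a3 m\<close> and \<open>B m\<close>, and \<open>a1\<close> must divide \<open>m\<close> itself.\<close>

lemma conjugate_colon_lattice:
  assumes "admissible (a1, B, a2 * a3)" "a2 > 0" "a3 > 0"
  shows "{z. \<forall>x\<in>form_lattice (a1, B, a2 * a3). cnj (z * x) \<in> form_lattice (a3, B, a1 * a2)}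
    = (*) (of_int a3 / form_root (a1, B, a2 * a3)) ` form_lattice (a2, B, a1 * a3)"
    (is "?K = ?R")
proof -
  define w where "w = form_root (a1, B, a2 * a3)"
  have disc: "discr (a1, B, a2 * a3) < 0" using assms by (simp add: admissible_def)
  have roots: "form_root (a3, B, a1 * a2) = w" "form_root (a2, B, a1 * a3) = w"
    by (simp_all add: w_def form_root_def mult.commute mult.left_commute)
  have a1: "a1 > 0" using assms(1) admissible_leading_pos by blast
  have cop: "coprime a1 (gcd B a3)"
    using assms(1) coprime_of_primitive unfolding admissible_def by blast
  have prod: "w * cnj w = of_int a1 * (of_int a2 * of_int a3)"
    using form_root_mult_cnj[OF disc] by (simp add: w_def)
  have sum: "cnj w = of_int B - w"
    using form_root_add_cnj[of a1 B "a2 * a3"] by (simp add: w_def algebra_simps)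
  have w0: "w \<noteq> 0" using form_root_nonzero[OF disc] by (simp add: w_def)
  have L1: "z \<in> form_lattice (a1, B, a2 * a3) \<longleftrightarrow> (\<exists>x y. z = of_int a1 * of_int x + w * of_int y)"
    and L2: "z \<in> form_lattice (a2, B, a1 * a3) \<longleftrightarrow> (\<exists>x y. z = of_int a2 * of_int x + w * of_int y)"
    for z by (simp_all add: form_lattice_iff roots w_def[symmetric])
  have L3: "cnj z \<in> form_lattice (a3, B, a1 * a2) \<longleftrightarrow>
      (\<exists>x y. z = of_int a3 * of_int x + cnj w * of_int y)" for z
  proof -
    have "cnj z = of_int a3 * of_int x + w * of_int y \<longleftrightarrow>
        z = of_int a3 * of_int x + cnj w * of_int y" for x y :: int
      by (auto simp: complex_eq_iff)
    thus ?thesis unfolding form_lattice_iff roots by simp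
  qed
  have "z \<in> ?K \<longleftrightarrow> z \<in> ?R" for z
  proof
    assume "z \<in> ?R"
    then obtain t where "t \<in> form_lattice (a2, B, a1 * a3)" "z = of_int a3 / w * t"
      unfolding w_def[symmetric] by blast
    then obtain x y where z: "z = of_int a3 / w * (of_int a2 * of_int x + w * of_int y)"
      unfolding L2 by blast
    have zw: "z * w = of_int a3 * (of_int a2 * of_int x + w * of_int y)" using w0 by (simp add: z)
    have "w * (z * of_int a1) = of_int a1 * (z * w)" by simp
    also have "\<dots> = (of_int a1 * (of_int a2 * of_int a3)) * of_int x + w * of_int (a1 * a3 * y)"
      unfolding zw by (simp add: algebra_simps)
    also have "\<dots> = w * (cnj w * of_int x + of_int (a1 * a3 * y))"
      unfolding prod[symmetric] by (simp add: algebra_simps)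
    finally have za: "z * of_int a1 = cnj w * of_int x + of_int (a1 * a3 * y)" using w0 by simp
    have "cnj (z * t) \<in> form_lattice (a3, B, a1 * a2)" if t: "t \<in> form_lattice (a1, B, a2 * a3)" for t
    proof -
      obtain m n where t: "t = of_int a1 * of_int m + w * of_int n" using t L1 by blast
      have "z * t = (z * of_int a1) * of_int m + (z * w) * of_int n"
        unfolding t by (simp add: algebra_simps)
      also have "\<dots> = of_int a3 * of_int (a1 * y * m + a2 * x * n + B * y * n)
          + cnj w * of_int (x * m - a3 * y * n)"
        unfolding za zw sum by (simp add: algebra_simps)
      finally show ?thesis using L3 by blast
    qed
    thus "z \<in> ?K" by blast
  next
    assume z: "z \<in> ?K"
    have "of_int a1 = of_int a1 * of_int 1 + w * of_int 0" by simp
    hence "of_int a1 \<in> form_lattice (a1, B, a2 * a3)" using L1 by blast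
    hence "cnj (z * of_int a1) \<in> form_lattice (a3, B, a1 * a2)" using z by blast
    then obtain m n where 1: "z * of_int a1 = of_int a3 * of_int m + cnj w * of_int n"
      using L3 by blast
    have "w = of_int a1 * of_int 0 + w * of_int 1" by simp
    hence "w \<in> form_lattice (a1, B, a2 * a3)" using L1 by blast
    hence "cnj (z * w) \<in> form_lattice (a3, B, a1 * a2)" using z by blast
    then obtain u v where 2: "z * w = of_int a3 * of_int u + cnj w * of_int v"
      using L3 by blast
    have "of_int a1 * (z * w) = w * (z * of_int a1)" by simp
    also have "\<dots> = w * of_int (a3 * m) + (w * cnj w) * of_int n"
      unfolding 1 by (simp add: algebra_simps)
    finally have azw: "of_int a1 * (z * w) = w * of_int (a3 * m) + of_int (a1 * a2 * a3 * n)"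
      unfolding prod by (simp add: algebra_simps)
    have "of_int (a1 * a3 * u + a1 * B * v - a1 * a2 * a3 * n) + w * of_int (- (a1 * v) - a3 * m) = 0"
      using azw unfolding 2 sum by (simp add: algebra_simps)
    from form_root_indep[OF disc this[unfolded w_def]]
    have e: "a1 * a3 * u + a1 * B * v = a1 * a2 * a3 * n" "a3 * m = - (a1 * v)" by auto
    have "a3 * (a1 * u - a1 * a2 * n) = - (B * (a1 * v))" using e(1) by (simp add: algebra_simps)
    also have "\<dots> = a3 * (B * m)" using e(2) by (simp add: algebra_simps)
    finally have "a3 * (B * m) = a3 * (a1 * (u - a2 * n))" by (simp add: right_diff_distrib mult.assoc)
    hence "B * m = a1 * (u - a2 * n)" using assms(3) by simp
    hence "a1 dvd B * m" by simp
    moreover have "a1 dvd a3 * m" using e(2) by simp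
    ultimately have "a1 dvd gcd (a3 * m) (B * m)" by simp
    hence "a1 dvd gcd B a3 * m" by (simp add: gcd_mult_right)
    hence "a1 dvd m" using cop by (simp add: coprime_dvd_mult_right_iff)
    then obtain k where m: "m = a1 * k" by blast
    have "of_int a1 * (z * w) = of_int a1 * (of_int a3 * (of_int a2 * of_int n + w * of_int k))"
      unfolding azw m by (simp add: algebra_simps)
    hence "z * w = of_int a3 * (of_int a2 * of_int n + w * of_int k)" using a1 by simp
    hence "z = of_int a3 / w * (of_int a2 * of_int n + w * of_int k)" using w0 by (simp add: field_simps)
    thus "z \<in> ?R" unfolding w_def[symmetric] using L2 by blast
  qed
  thus ?thesis by blast
qed

section \<open>Triples of classes with trivial product\<close>

text \<open>In the usual notation of Dirichlet composition, \<open>(a1, B, a2 a3)\<close> and \<open>(a2, B, a1 a3)\<close> compose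
  to \<open>(a1 a2, B, a3)\<close>. The inverse of that class contains \<open>(a3, B, a1 a2)\<close>, so using the inverse makes the
  relation symmetric in its three arguments.\<close>

definition trivial_product :: "bqf \<Rightarrow> bqf \<Rightarrow> bqf \<Rightarrow> bool" where
  "trivial_product f g h \<longleftrightarrow> (\<exists>a1 a2 a3 B.
     f \<approx> (a1, B, a2 * a3) \<and> g \<approx> (a2, B, a1 * a3) \<and> h \<approx> (a3, B, a1 * a2))"

lemma trivial_product_swap: "trivial_product f g h \<Longrightarrow> trivial_product g f h"
  unfolding trivial_product_def by (metis mult.commute)

lemma trivial_product_rotate: "trivial_product f g h \<Longrightarrow> trivial_product g h f"
  unfolding trivial_product_def by (metis mult.commute)

text \<open>Replacing \<open>f\<close> and \<open>h\<close> by equivalent forms scales their lattices by \<open>l\<close> and \<open>m\<close>, hence scales the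
  lattice that \<open>conjugate_colon_lattice\<close> describes by \<open>cnj m / l\<close>. So the lattices of the two candidates
  for the middle form are similar.\<close>

lemma trivial_product_unique:
  assumes adm: "admissible f" "admissible g" "admissible g'" "admissible h"
    and T: "trivial_product f g h" "trivial_product f g' h"
  shows "g \<approx> g'"
proof -
  obtain a1 a2 a3 B where e:
    "f \<approx> (a1, B, a2 * a3)" "g \<approx> (a2, B, a1 * a3)" "h \<approx> (a3, B, a1 * a2)"
    using T unfolding trivial_product_def by blast
  obtain b1 b2 b3 C where e':
    "f \<approx> (b1, C, b2 * b3)" "g' \<approx> (b2, C, b1 * b3)" "h \<approx> (b3, C, b1 * b2)"
    using T unfolding trivial_product_def by blast
  define F where "F = (a1, B, a2 * a3)"
  define G where "G = (a2, B, a1 * a3)"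
  define H where "H = (a3, B, a1 * a2)"
  define F' where "F' = (b1, C, b2 * b3)"
  define G' where "G' = (b2, C, b1 * b3)"
  define H' where "H' = (b3, C, b1 * b2)"
  note defs = F_def G_def H_def F'_def G'_def H'_def
  have adm': "admissible F" "admissible G" "admissible H" "admissible F'" "admissible G'" "admissible H'"
    using e e' adm properly_equiv_admissible unfolding defs by blast+
  have "F \<approx> F'" "H \<approx> H'"
    using e e' properly_equiv_sym properly_equiv_trans unfolding defs by blast+
  then obtain l m where l: "l \<noteq> 0" "form_lattice F' = (*) l ` form_lattice F"
    and m: "m \<noteq> 0" "form_lattice H' = (*) m ` form_lattice H"
    using properly_equiv_imp_similar adm' by metis
  define K where "K = {z. \<forall>x\<in>form_lattice F. cnj (z * x) \<in> form_lattice H}"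
  define K' where "K' = {z. \<forall>x\<in>form_lattice F'. cnj (z * x) \<in> form_lattice H'}"
  define r where "r = of_int a3 / form_root F"
  define r' where "r' = of_int b3 / form_root F'"
  have pos: "a2 > 0" "a3 > 0" "b2 > 0" "b3 > 0"
    using adm' admissible_leading_pos unfolding defs by blast+
  have K: "K = (*) r ` form_lattice G" and K': "K' = (*) r' ` form_lattice G'"
    using conjugate_colon_lattice adm' pos unfolding K_def K'_def r_def r'_def defs by blast+
  have rr: "r \<noteq> 0" "r' \<noteq> 0"
    using adm' pos form_root_nonzero by (auto simp: r_def r'_def admissible_def)
  have KK: "z \<in> K' \<longleftrightarrow> l / cnj m * z \<in> K" for z
  proof -
    have "cnj (z * (l * x)) \<in> (*) m ` form_lattice H \<longleftrightarrow> cnj (l / cnj m * z * x) \<in> form_lattice H" for x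
    proof -
      have "cnj (z * (l * x)) = m * cnj (l / cnj m * z * x)" using m by simp
      moreover have "m * t \<in> (*) m ` L \<longleftrightarrow> t \<in> L" for t L using m(1) by auto
      ultimately show ?thesis by (simp only:)
    qed
    thus ?thesis unfolding K_def K'_def l m by simp
  qed
  define t where "t = cnj m / l * r / r'"
  have "form_lattice G' = (*) t ` form_lattice G"
  proof (intro set_eqI)
    fix z
    have "z \<in> form_lattice G' \<longleftrightarrow> r' * z \<in> K'" using rr by (auto simp: K')
    also have "\<dots> \<longleftrightarrow> l / cnj m * (r' * z) \<in> K" by (rule KK)
    also have "\<dots> \<longleftrightarrow> (\<exists>x\<in>form_lattice G. l / cnj m * (r' * z) = r * x)" by (auto simp: K)
    also have "\<dots> \<longleftrightarrow> (\<exists>x\<in>form_lattice G. z = t * x)"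
      using rr l(1) m(1) by (auto simp: t_def field_simps)
    also have "\<dots> \<longleftrightarrow> z \<in> (*) t ` form_lattice G" by auto
    finally show "z \<in> form_lattice G' \<longleftrightarrow> z \<in> (*) t ` form_lattice G" .
  qed
  moreover have "t \<noteq> 0" using rr l m by (simp add: t_def)
  moreover have "discr G' = discr G"
  proof -
    have "discr G = discr F" "discr G' = discr F'" by (simp_all add: defs)
    thus ?thesis using properly_equiv_discr[OF \<open>F \<approx> F'\<close>] by simp
  qed
  ultimately have "G \<approx> G'" using similar_imp_properly_equiv adm' by blast
  thus ?thesis using e e' properly_equiv_sym properly_equiv_trans unfolding defs by blast
qed

lemma trivial_product_cong:
  assumes "f \<approx> f'" "g \<approx> g'" "h \<approx> h'" "trivial_product f g h"
  shows "trivial_product f' g' h'"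
proof -
  obtain a1 a2 a3 B where
    "f \<approx> (a1, B, a2 * a3)" "g \<approx> (a2, B, a1 * a3)" "h \<approx> (a3, B, a1 * a2)"
    using assms(4) unfolding trivial_product_def by blast
  hence "f' \<approx> (a1, B, a2 * a3)" "g' \<approx> (a2, B, a1 * a3)" "h' \<approx> (a3, B, a1 * a2)"
    using assms(1-3)[THEN properly_equiv_sym] properly_equiv_trans by blast+
  thus ?thesis unfolding trivial_product_def by blast
qed

text \<open>Dirichlet's composition identity: with \<open>X = x u - a3 y v\<close> and
  \<open>Y = a1 x v + a2 y u + B y v\<close>,
  \<open>(a1 x\<^sup>2 + B x y + a2 a3 y\<^sup>2) (a2 u\<^sup>2 + B u v + a1 a3 v\<^sup>2) = a1 a2 X\<^sup>2 + B X Y + a3 Y\<^sup>2\<close>.\<close>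

lemma trivial_product_represents:
  assumes "trivial_product f g h" "represents f m" "represents g n"
  shows "represents h (m * n)"
proof -
  obtain a1 a2 a3 B where e:
    "f \<approx> (a1, B, a2 * a3)" "g \<approx> (a2, B, a1 * a3)" "h \<approx> (a3, B, a1 * a2)"
    using assms unfolding trivial_product_def by blast
  have "represents (a1, B, a2 * a3) m" "represents (a2, B, a1 * a3) n"
    using assms e properly_equiv_represents by blast+
  then obtain x y u v where m: "m = form_val (a1, B, a2 * a3) x y"
    and n: "n = form_val (a2, B, a1 * a3) u v"
    unfolding represents_def by metis
  have "form_val (a3, B, a1 * a2) (a1 * x * v + a2 * y * u + B * y * v) (x * u - a3 * y * v) = m * n"
    unfolding m n form_val.simps by algebra
  hence "represents (a3, B, a1 * a2) (m * n)" unfolding represents_def by blast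
  thus ?thesis using e properly_equiv_represents by blast
qed

lemma coprime_iff_primitive: "coprime a b \<longleftrightarrow> primitive_form (a, b, b)"
  by (simp add: coprime_iff_gcd_eq_1)

text \<open>By primitivity, a prime \<open>p\<close> dividing \<open>n\<close> fails to divide one of \<open>a\<close>, \<open>c\<close>, \<open>b\<close>. Letting \<open>p\<close> divide only \<open>y\<close>, only
  \<open>x\<close>, or neither of them leaves exactly the corresponding term of the form nonzero modulo \<open>p\<close>. The products of
  the primes of the first two kinds are coprime by construction.\<close>

lemma exists_coprime_value:
  assumes "primitive_form (a, b, c)" "n \<noteq> 0"
  shows "\<exists>x y. coprime x y \<and> coprime (form_val (a, b, c) x y) n"
proof -
  define X where "X = {p. prime p \<and> p dvd n \<and> p dvd a \<and> \<not> p dvd c}"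
  define Y where "Y = {p. prime p \<and> p dvd n \<and> \<not> p dvd a}"
  have fin: "finite X" "finite Y"
    using finite_divisors_int[OF assms(2)] by (auto simp: X_def Y_def)
  have pX: "p dvd \<Prod>X \<longleftrightarrow> p \<in> X" and pY: "p dvd \<Prod>Y \<longleftrightarrow> p \<in> Y" if "prime p" for p
  proof -
    have "p dvd \<Prod>Z \<longleftrightarrow> p \<in> Z" if Z: "finite Z" "\<forall>q\<in>Z. prime q" for Z
    proof -
      have "p dvd \<Prod>Z \<longleftrightarrow> (\<exists>q\<in>Z. p dvd q)" using prime_dvd_prod_iff[OF Z(1) \<open>prime p\<close>] .
      also have "\<dots> \<longleftrightarrow> (\<exists>q\<in>Z. p = q)"
        using primes_dvd_imp_eq[OF \<open>prime p\<close>] Z(2) by (intro bex_cong) auto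
      finally show ?thesis by simp
    qed
    from this[OF fin(1)] this[OF fin(2)]
    show "p dvd \<Prod>X \<longleftrightarrow> p \<in> X" "p dvd \<Prod>Y \<longleftrightarrow> p \<in> Y" by (simp_all add: X_def Y_def)
  qed
  have "coprime (\<Prod>X) (\<Prod>Y)"
    unfolding coprime_iff_primitive primitive_form_iff using pX pY by (auto simp: X_def Y_def)
  moreover have "coprime (form_val (a, b, c) (\<Prod>X) (\<Prod>Y)) n"
    unfolding coprime_iff_primitive primitive_form_iff
  proof (intro allI impI notI, elim conjE)
    fix p assume p: "prime p" "p dvd form_val (a, b, c) (\<Prod>X) (\<Prod>Y)" "p dvd n"
    define x where "x = \<Prod>X"
    define y where "y = \<Prod>Y"
    have v: "p dvd a * x\<^sup>2 + b * x * y + c * y\<^sup>2" using p(2) by (simp add: x_def y_def)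
    have x: "p dvd x \<longleftrightarrow> p dvd a \<and> \<not> p dvd c" and y: "p dvd y \<longleftrightarrow> \<not> p dvd a"
      using pX[OF p(1)] pY[OF p(1)] p by (simp_all add: X_def Y_def x_def y_def)
    have mult: "p dvd s * t \<longleftrightarrow> p dvd s \<or> p dvd t" for s t by (rule prime_dvd_mult_iff[OF p(1)])
    consider "\<not> p dvd a" | "p dvd a" "\<not> p dvd c" | "p dvd a" "p dvd c" "\<not> p dvd b"
      using assms(1) p(1) unfolding primitive_form_iff by blast
    thus False
    proof cases
      case 1
      hence "p dvd b * x * y + c * y\<^sup>2" using y by (simp add: power2_eq_square)
      hence "p dvd a * x\<^sup>2" using v by (simp add: add.assoc dvd_add_left_iff)
      thus False using 1 x by (simp add: mult power2_eq_square)
    next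
      case 2
      hence "p dvd a * x\<^sup>2 + b * x * y" using x by simp
      hence "p dvd c * y\<^sup>2" using v by (simp add: dvd_add_right_iff)
      thus False using 2 y by (simp add: mult power2_eq_square)
    next
      case 3
      hence "p dvd b * x * y" using v by (simp add: dvd_add_left_iff dvd_add_right_iff)
      thus False using 3 x y by (simp add: mult)
    qed
  qed
  ultimately show ?thesis by blast
qed

lemma exists_coprime_leading_coefficient:
  assumes "primitive_form f" "n \<noteq> 0"
  shows "\<exists>a b c. f \<approx> (a, b, c) \<and> coprime a n"
proof -
  obtain a b c where f: "f = (a, b, c)" by (metis prod_cases3)
  obtain x y where xy: "coprime x y" "coprime (form_val f x y) n"
    using exists_coprime_value assms unfolding f by blast
  obtain u v where "u * x + v * y = 1" using bezout_int[of x y] xy(1) by auto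
  hence "x * u - (- v) * y = 1" by (simp add: algebra_simps)
  from properly_equiv_matrix[OF this, of a b c] show ?thesis
    using xy(2) unfolding f form_val.simps by blast
qed

text \<open>Once the leading coefficients \<open>a1\<close> of \<open>f\<close> and \<open>a3\<close> of \<open>h\<close> are coprime, both forms can be
  translated to the same middle coefficient \<open>B\<close>. Then \<open>B\<^sup>2 - \<Delta>\<close> is divisible by \<open>4 a1 a3\<close>, and the quotient is
  the coefficient \<open>a2\<close>.\<close>

lemma trivial_product_exists:
  assumes "admissible f" "admissible h" "discr f = discr h"
  shows "\<exists>g. trivial_product f g h \<and> admissible g \<and> discr g = discr f"
proof -
  obtain a3 b3 c3 where h: "h = (a3, b3, c3)" by (metis prod_cases3)
  have a3: "a3 > 0" using assms(2) admissible_leading_pos unfolding h by blast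
  obtain a1 b1 c1 where f: "f \<approx> (a1, b1, c1)" and cop: "coprime a1 a3"
    using exists_coprime_leading_coefficient[of f a3] assms(1) a3 by (auto simp: admissible_def)
  have a1: "a1 > 0"
    using properly_equiv_admissible[OF f assms(1)] admissible_leading_pos by blast
  have "b1\<^sup>2 - 4 * a1 * c1 = b3\<^sup>2 - 4 * a3 * c3"
    using properly_equiv_discr[OF f] assms(3) by (simp add: h)
  hence "(b3 - b1) * (b3 + b1) = 2 * (2 * (a3 * c3 - a1 * c1))"
    by (simp add: power2_eq_square algebra_simps)
  hence "even ((b3 - b1) * (b3 + b1))" by simp
  hence "even (b3 - b1)" by auto
  then obtain e where e: "b3 - b1 = 2 * e" by blast
  obtain u v where uv: "u * a1 + v * a3 = 1" using bezout_int[of a1 a3] cop by auto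
  (* the common middle coefficient, congruent to b1 modulo 2 a1 and to b3 modulo 2 a3 *)
  define B where "B = b1 + 2 * a1 * (u * e)"
  define C1 where "C1 = a1 * (u * e)\<^sup>2 + b1 * (u * e) + c1"
  define C3 where "C3 = a3 * (- (v * e))\<^sup>2 + b3 * (- (v * e)) + c3"
  have "B = b1 + 2 * ((u * a1 + v * a3) * e) + 2 * a3 * (- (v * e))"
    by (simp add: B_def algebra_simps)
  hence B3: "B = b3 + 2 * a3 * (- (v * e))" using e by (simp add: uv)
  have f': "f \<approx> (a1, B, C1)"
    using properly_equiv_trans[OF f properly_equiv_translate] by (simp add: B_def C1_def)
  have h': "h \<approx> (a3, B, C3)"
    unfolding h B3 C3_def by (rule properly_equiv_translate)
  have D1: "B\<^sup>2 - 4 * a1 * C1 = discr f" and D3: "B\<^sup>2 - 4 * a3 * C3 = discr f"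
    using properly_equiv_discr[OF f'] properly_equiv_discr[OF h'] assms(3) by simp_all
  hence eq: "a1 * C1 = a3 * C3" by simp
  hence "a3 dvd a1 * C1" by simp
  hence "a3 dvd C1" using cop by (simp add: coprime_commute coprime_dvd_mult_right_iff)
  then obtain a2 where C1: "C1 = a3 * a2" by blast
  hence C3: "C3 = a1 * a2" using eq a3 by (simp add: algebra_simps)
  have F: "f \<approx> (a1, B, a2 * a3)" and H: "h \<approx> (a3, B, a1 * a2)"
    using f' h' by (simp_all add: C1 C3 mult.commute)
  define g where "g = (a2, B, a1 * a3)"
  have T: "trivial_product f g h"
    unfolding trivial_product_def g_def using F H properly_equiv_refl by blast
  have dg: "discr g = discr f" using D1 by (simp add: g_def C1 algebra_simps)
  have df: "discr f < 0" using assms(1) by (simp add: admissible_def)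
  have "0 < 4 * a1 * C1" using D1 df zero_le_power2[of B] by linarith
  hence "0 < C1" using a1 by (simp add: zero_less_mult_iff)
  hence "a2 > 0" using a3 by (simp add: C1 zero_less_mult_iff)
  hence "pos_def_form g" using pos_def_form_iff dg df unfolding g_def by metis
  moreover have "primitive_form g"
    unfolding g_def primitive_form_iff
  proof (intro allI impI notI, elim conjE)
    fix p assume p: "prime p" "p dvd a2" "p dvd B" "p dvd a1 * a3"
    have "primitive_form (a1, B, a2 * a3)" "primitive_form (a3, B, a1 * a2)"
      using F H properly_equiv_primitive assms unfolding admissible_def by blast+
    moreover have "p dvd a1 \<or> p dvd a3" using p(1,4) prime_dvd_mult_iff by blast
    ultimately show False using p(1-3) unfolding primitive_form_iff by (metis dvd_mult dvd_mult2)
  qed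
  ultimately have "admissible g" using dg df by (simp add: admissible_def)
  with T dg show ?thesis by blast
qed

lemma trivial_product_inverse: "trivial_product (a, b, c) (a, - b, c) (1, b, a * c)"
  unfolding trivial_product_def
proof (intro exI conjI)
  show "(a, b, c) \<approx> (a, b, c * 1)" by simp
  show "(a, - b, c) \<approx> (c, b, a * 1)" using properly_equiv_swap[of a "- b" c] by simp
qed simp

lemma properly_equiv_principal:
  assumes "discr (1, b, c) = \<Delta>"
  shows "(1, b, c) \<approx> principal_form \<Delta>"
proof (cases "even b")
  case True
  then obtain k where b: "b = 2 * k" by blast
  have "\<Delta> = 4 * (k\<^sup>2 - c)" using assms by (simp add: b power2_eq_square algebra_simps)
  hence "principal_form \<Delta> = (1, b + 2 * 1 * - k, 1 * (- k)\<^sup>2 + b * - k + c)"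
    by (simp add: principal_form_def b power2_eq_square)
  thus ?thesis using properly_equiv_translate[of 1 b c "- k"] by simp
next
  case False
  then obtain k where b: "b = 2 * k + 1" by (rule oddE)
  have D: "\<Delta> = 1 + 4 * (k\<^sup>2 + k - c)" using assms by (simp add: b power2_eq_square algebra_simps)
  have "\<Delta> mod 4 = 1" unfolding D by presburger
  moreover have "(1 - \<Delta>) div 4 = c - k\<^sup>2 - k" unfolding D by simp
  ultimately have "principal_form \<Delta> = (1, b + 2 * 1 * - k, 1 * (- k)\<^sup>2 + b * - k + c)"
    by (simp add: principal_form_def b power2_eq_square algebra_simps)
  thus ?thesis using properly_equiv_translate[of 1 b c "- k"] by simp
qed

section \<open>Odd class number\<close>

text \<open>Used twice: it makes \<open>card A\<close> even, which forces fixed points on sets of odd size, and it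
  enumerates the pairs \<open>{Q, Q\<^sup>-\<^sup>1}\<close>.\<close>

lemma involution_without_fixpoint_pairs:
  assumes "finite A" "\<And>x. x \<in> A \<Longrightarrow> f x \<in> A \<and> f (f x) = x \<and> f x \<noteq> x"
  shows "\<exists>n g. card A = 2 * n \<and> A = (\<Union>i\<in>{1..n::nat}. {g i, f (g i)})"
  using assms
proof (induction A rule: finite_psubset_induct)
  case (psubset A)
  show ?case
  proof (cases "A = {}")
    case True
    thus ?thesis by (intro exI[of _ 0]) simp
  next
    case False
    then obtain x where x: "x \<in> A" by blast
    define A' where "A' = A - {x, f x}"
    have inv: "f y \<in> A' \<and> f (f y) = y \<and> f y \<noteq> y" if "y \<in> A'" for y
      using that psubset.prems x unfolding A'_def by (metis DiffE DiffI insertCI insertE singletonD)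
    have "A' \<subset> A" using x by (auto simp: A'_def)
    then obtain n g where n: "card A' = 2 * n" and g: "A' = (\<Union>i\<in>{1..n::nat}. {g i, f (g i)})"
      using psubset.IH[OF _ inv] by metis
    have fx: "f x \<in> A" "f x \<noteq> x" using psubset.prems x by blast+
    have A: "A = insert x (insert (f x) A')" using x fx by (auto simp: A'_def)
    have fin: "finite A'" using psubset.hyps(1) by (simp add: A'_def)
    have "card A = 2 * Suc n"
      using fx fin n unfolding A by (simp add: card_insert_if) (auto simp: A'_def)
    moreover have "A = (\<Union>i\<in>{1..Suc n}. {(g(Suc n := x)) i, f ((g(Suc n := x)) i)})"
    proof -
      have "{1..Suc n} = insert (Suc n) {1..n}" by auto
      moreover have "(\<Union>i\<in>{1..n}. {(g(Suc n := x)) i, f ((g(Suc n := x)) i)}) = A'"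
        unfolding g by (intro SUP_cong) auto
      ultimately show ?thesis by (auto simp: A)
    qed
    ultimately show ?thesis by blast
  qed
qed

lemma forms_admissible:
  assumes "\<Delta> < 0" "Q \<in> forms \<Delta>"
  shows "admissible Q" "discr Q = \<Delta>"
  using assms by (auto simp: forms_def admissible_def)

lemma exists_form_of_class:
  assumes "admissible f" "discr f = \<Delta>"
  shows "\<exists>Q \<in> forms \<Delta>. f \<approx> Q"
proof -
  obtain g where g: "reduced_form g" "f \<approx> g"
    using exists_reduced assms unfolding admissible_def by blast
  hence "g \<in> forms \<Delta>"
    using properly_equiv_admissible[OF g(2) assms(1)] properly_equiv_discr[OF g(2)] assms(2)
    by (simp add: forms_def admissible_def)
  with g show ?thesis by blast
qed

lemma forms_unique:
  assumes "\<Delta> < 0" "f \<in> forms \<Delta>" "g \<in> forms \<Delta>" "f \<approx> g"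
  shows "f = g"
  using reduced_form_unique assms by (simp add: forms_def)

lemma forms_third_exists:
  assumes "\<Delta> < 0" "f \<in> forms \<Delta>" "h \<in> forms \<Delta>"
  shows "\<exists>g \<in> forms \<Delta>. trivial_product f g h"
proof -
  obtain g where g: "trivial_product f g h" "admissible g" "discr g = \<Delta>"
    using trivial_product_exists forms_admissible[OF assms(1)] assms(2,3) by metis
  then obtain Q where "Q \<in> forms \<Delta>" "g \<approx> Q" using exists_form_of_class by blast
  thus ?thesis using trivial_product_cong g properly_equiv_refl by blast
qed

lemma forms_third_unique:
  assumes "\<Delta> < 0" "f \<in> forms \<Delta>" "g \<in> forms \<Delta>" "g' \<in> forms \<Delta>" "h \<in> forms \<Delta>"
    and "trivial_product f g h" "trivial_product f g' h"
  shows "g = g'"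
proof (rule forms_unique[OF assms(1,3,4)])
  show "g \<approx> g'"
    using assms(2-5)[THEN forms_admissible(1)[OF assms(1)]] assms(6,7)
    by (rule trivial_product_unique)
qed

lemma forms_square_unique:
  assumes "\<Delta> < 0" "f \<in> forms \<Delta>" "h \<in> forms \<Delta>" "h' \<in> forms \<Delta>"
    and "trivial_product f f h" "trivial_product f f h'"
  shows "h = h'"
proof (rule forms_third_unique[OF assms(1,2,3,4,2)])
  show "trivial_product f h f" "trivial_product f h' f"
    using assms(5,6) trivial_product_rotate by blast+
qed

lemma finite_forms_of_odd:
  assumes "odd (class_number \<Delta>)"
  shows "finite (forms \<Delta>)"
proof (rule ccontr)
  assume "infinite (forms \<Delta>)"
  thus False using assms by (simp add: class_number_def)
qed

text \<open>The involution \<open>f \<mapsto> (f h)\<^sup>-\<^sup>1\<close> on an odd number of classes has a fixed point.\<close>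

lemma exists_square_root:
  assumes "\<Delta> < 0" "odd (class_number \<Delta>)" "h \<in> forms \<Delta>"
  shows "\<exists>f \<in> forms \<Delta>. trivial_product f f h"
proof (rule ccontr)
  assume no: "\<not> ?thesis"
  define F where "F f = (SOME g. g \<in> forms \<Delta> \<and> trivial_product f g h)" for f
  have F: "F f \<in> forms \<Delta> \<and> trivial_product f (F f) h" if "f \<in> forms \<Delta>" for f
    unfolding F_def using forms_third_exists[OF assms(1) that assms(3)] unfolding Bex_def
    by (rule someI_ex)
  have "F (F f) = f" if "f \<in> forms \<Delta>" for f
  proof (rule forms_third_unique[OF assms(1) _ _ that assms(3)])
    show "F f \<in> forms \<Delta>" "F (F f) \<in> forms \<Delta>" "trivial_product (F f) (F (F f)) h"
      using F that by blast+
    show "trivial_product (F f) f h" using F[OF that] trivial_product_swap by blast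
  qed
  moreover have "F f \<noteq> f" if "f \<in> forms \<Delta>" for f
    using F[OF that] that no by metis
  ultimately obtain n where "card (forms \<Delta>) = 2 * n"
    using involution_without_fixpoint_pairs[of "forms \<Delta>" F] finite_forms_of_odd[OF assms(2)] F
    by blast
  thus False using assms(2) by (simp add: class_number_def)
qed

text \<open>A choice \<open>r\<close> of roots is injective, since \<open>h\<close> is determined by \<open>f\<^sup>2 h = 1\<close>. By finiteness it is
  surjective, so any root \<open>k\<close> of \<open>h\<close> is \<open>r h'\<close> for some \<open>h'\<close>, and then \<open>h' = h\<close>.\<close>

lemma square_root_unique:
  assumes "\<Delta> < 0" "odd (class_number \<Delta>)" "h \<in> forms \<Delta>"
    and "f \<in> forms \<Delta>" "g \<in> forms \<Delta>" "trivial_product f f h" "trivial_product g g h"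
  shows "f = g"
proof -
  define r where "r h = (SOME f. f \<in> forms \<Delta> \<and> trivial_product f f h)" for h
  have r: "r h \<in> forms \<Delta> \<and> trivial_product (r h) (r h) h" if "h \<in> forms \<Delta>" for h
    unfolding r_def using exists_square_root[OF assms(1,2) that] unfolding Bex_def
    by (rule someI_ex)
  note sq = forms_square_unique[OF assms(1)]
  have "inj_on r (forms \<Delta>)"
  proof (rule inj_onI)
    fix h h' assume h: "h \<in> forms \<Delta>" "h' \<in> forms \<Delta>" "r h = r h'"
    show "h = h'" using sq[of "r h" h h'] r[OF h(1)] r[OF h(2)] h by simp
  qed
  hence surj: "r ` forms \<Delta> = forms \<Delta>"
    using r by (intro endo_inj_surj finite_forms_of_odd assms(2)) auto
  have "k = r h" if k: "k \<in> forms \<Delta>" "trivial_product k k h" for k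
  proof -
    obtain h' where h': "h' \<in> forms \<Delta>" "k = r h'" using surj k by blast
    hence "h' = h" using sq[of k h' h] r[OF h'(1)] k assms(3) by simp
    thus ?thesis using h' by simp
  qed
  thus ?thesis using assms by metis
qed

text \<open>Some member of \<open>forms \<Delta>\<close> is assumed because an integer congruent to \<open>2\<close> or \<open>3\<close> modulo \<open>4\<close> is
  not a discriminant, and \<open>principal_form\<close> is meaningless there.\<close>

lemma principal_in_forms:
  assumes "\<Delta> < 0" "Q \<in> forms \<Delta>"
  shows "principal_form \<Delta> \<in> forms \<Delta>"
proof -
  obtain a b c where Q: "Q = (a, b, c)" by (metis prod_cases3)
  have D: "discr (1, b, a * c) = \<Delta>" using forms_admissible(2)[OF assms] by (simp add: Q)
  have "primitive_form (1, b, a * c)" by simp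
  moreover have "pos_def_form (1, b, a * c)" using pos_def_form_iff D assms(1) by simp
  ultimately have "admissible (1, b, a * c)" using D assms(1) by (simp add: admissible_def)
  note P = properly_equiv_principal[OF D]
  have "admissible (principal_form \<Delta>)" using properly_equiv_admissible P \<open>admissible _\<close> by blast
  moreover have "discr (principal_form \<Delta>) = \<Delta>" using properly_equiv_discr[OF P] D by simp
  moreover have "reduced_form (principal_form \<Delta>)"
  proof (cases "\<Delta> mod 4 = 0")
    case True
    hence "- (\<Delta> div 4) \<ge> 1" using assms(1) by presburger
    thus ?thesis using True by (simp add: principal_form_def)
  next
    case False
    hence "(1 - \<Delta>) div 4 \<ge> 1"
      using assms(1) \<open>discr (principal_form \<Delta>) = \<Delta>\<close>
      by (simp add: principal_form_def)
    thus ?thesis using False by (simp add: principal_form_def)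
  qed
  ultimately show ?thesis by (simp add: forms_def admissible_def)
qed

lemma forms_inverse_product:
  assumes "\<Delta> < 0" "(a, b, c) \<in> forms \<Delta>"
  shows "trivial_product (a, b, c) (a, - b, c) (principal_form \<Delta>)"
proof -
  have "discr (1, b, a * c) = \<Delta>" using forms_admissible(2)[OF assms] by simp
  thus ?thesis
    using trivial_product_cong[OF _ _ _ trivial_product_inverse] properly_equiv_principal
      properly_equiv_refl by blast
qed

lemma ambiguous_form_square:
  assumes "\<Delta> < 0" "(a, b, c) \<in> forms \<Delta>" "(a, b, c) \<approx> (a, - b, c)"
  shows "trivial_product (a, b, c) (a, b, c) (principal_form \<Delta>)"
  using properly_equiv_refl properly_equiv_sym[OF assms(3)] properly_equiv_refl
    forms_inverse_product[OF assms(1,2)]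
  by (rule trivial_product_cong)

lemma principal_form_square:
  assumes "\<Delta> < 0" "principal_form \<Delta> \<in> forms \<Delta>"
  shows "trivial_product (principal_form \<Delta>) (principal_form \<Delta>) (principal_form \<Delta>)"
proof -
  obtain p q r where p: "principal_form \<Delta> = (p, q, r)" by (metis prod_cases3)
  have "q = 0 \<or> p = 1 \<and> q = 1" using p by (auto simp: principal_form_def split: if_splits)
  hence "(p, q, r) \<approx> (p, - q, r)" using properly_equiv_translate[of 1 1 r "-1"] by auto
  thus ?thesis using ambiguous_form_square[of \<Delta> p q r] assms unfolding p by blast
qed

text \<open>A form equivalent to its inverse and the principal form are both square roots of the principal
  class.\<close>

lemma ambiguous_form_principal:
  assumes "\<Delta> < 0" "odd (class_number \<Delta>)" "(a, b, c) \<in> forms \<Delta>" "(a, b, c) \<approx> (a, - b, c)"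
  shows "(a, b, c) = principal_form \<Delta>"
proof -
  have P: "principal_form \<Delta> \<in> forms \<Delta>" using principal_in_forms assms by blast
  show ?thesis
    using square_root_unique[OF assms(1,2) P assms(3) P]
      ambiguous_form_square[OF assms(1,3,4)] principal_form_square[OF assms(1) P] by blast
qed

text \<open>If \<open>(a, b, c)\<close> lies on the boundary of the reduced domain, that is \<open>\<bar>b\<bar> = a\<close> or \<open>a = c\<close>, it is equivalent to
  \<open>(a, -b, c)\<close>, so it is principal. Away from the boundary, changing the sign of \<open>b\<close>
  preserves reducedness.\<close>

lemma nonprincipal_inverse:
  assumes "\<Delta> < 0" "odd (class_number \<Delta>)" "(a, b, c) \<in> forms \<Delta> - {principal_form \<Delta>}"
  shows "(a, - b, c) \<in> forms \<Delta> - {principal_form \<Delta>}" "b \<noteq> 0"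
proof -
  have Q: "(a, b, c) \<in> forms \<Delta>" and na: "\<not> (a, b, c) \<approx> (a, - b, c)"
    using assms ambiguous_form_principal by blast+
  have red: "\<bar>b\<bar> \<le> a" "a \<le> c" "\<bar>b\<bar> = a \<or> a = c \<longrightarrow> b \<ge> 0"
    using Q by (simp_all add: forms_def)
  show b0: "b \<noteq> 0" using na by auto
  have "\<not> (\<bar>b\<bar> = a \<or> a = c)"
  proof
    assume *: "\<bar>b\<bar> = a \<or> a = c"
    with red have "b = a \<or> a = c" by auto
    thus False using na properly_equiv_translate[of a a c "-1"] properly_equiv_swap[of a b a] by auto
  qed
  hence strict: "\<bar>b\<bar> < a" "a < c" using red by auto
  have "primitive_form (a, - b, c)" "discr (a, - b, c) = \<Delta>" "a > 0"
    using Q strict by (auto simp: forms_def)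
  hence "(a, - b, c) \<in> forms \<Delta>"
    using strict assms(1) pos_def_form_iff[of a "- b" c] by (simp add: forms_def)
  moreover have "(a, - b, c) \<noteq> principal_form \<Delta>"
    using strict b0 by (auto simp: principal_form_def)
  ultimately show "(a, - b, c) \<in> forms \<Delta> - {principal_form \<Delta>}" by blast
qed

lemma exists_inverse_pairing:
  assumes "\<Delta> < 0" "odd (class_number \<Delta>)"
  shows "\<exists>n a b c. inverse_pairing \<Delta> n a b c"
proof -
  define N where "N = forms \<Delta> - {principal_form \<Delta>}"
  define inv where "inv Q = (fst Q, - fst (snd Q), snd (snd Q))" for Q :: bqf
  have fin: "finite (forms \<Delta>)" using finite_forms_of_odd assms by blast
  have "forms \<Delta> \<noteq> {}" using assms(2) by (auto simp: class_number_def)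
  hence P: "principal_form \<Delta> \<in> forms \<Delta>" using principal_in_forms assms by blast
  have "inv Q \<in> N \<and> inv (inv Q) = Q \<and> inv Q \<noteq> Q" if "Q \<in> N" for Q
  proof -
    obtain a b c where Q: "Q = (a, b, c)" by (metis prod_cases3)
    show ?thesis
      using nonprincipal_inverse[OF assms, of a b c] that by (simp add: inv_def Q N_def)
  qed
  then obtain n g where n: "card N = 2 * n" and g: "N = (\<Union>i\<in>{1..n::nat}. {g i, inv (g i)})"
    using involution_without_fixpoint_pairs[of N inv] fin unfolding N_def by blast
  have "class_number \<Delta> = 2 * n + 1"
    using n P fin card_Suc_Diff1[OF fin P] by (simp add: class_number_def N_def)
  hence "inverse_pairing \<Delta> n (\<lambda>i. fst (g i)) (\<lambda>i. fst (snd (g i))) (\<lambda>i. snd (snd (g i)))"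
    unfolding inverse_pairing_def using g by (simp add: N_def inv_def)
  thus ?thesis by blast
qed

lemma represents_inverse: "represents (a, - b, c) m \<longleftrightarrow> represents (a, b, c) m"
proof -
  have "form_val (a, - b, c) x y = form_val (a, b, c) x (- y)" for x y by simp
  thus ?thesis unfolding represents_def by (metis minus_minus)
qed

lemma represents_outer_coefficients: "represents (a, b, c) a" "represents (a, b, c) c"
proof -
  have "form_val (a, b, c) 1 0 = a" "form_val (a, b, c) 0 1 = c" by simp_all
  thus "represents (a, b, c) a" "represents (a, b, c) c" unfolding represents_def by blast+
qed

text \<open>The triple \<open>Q\<^sup>-\<^sup>1\<close>, \<open>1\<close>, \<open>Q\<close> has product \<open>1\<close>, and \<open>Q\<^sup>-\<^sup>1\<close> has the same values as \<open>Q\<close>.\<close>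

lemma principal_represents_mult:
  assumes "\<Delta> < 0" "Q \<in> forms \<Delta>" "represents Q m" "represents (principal_form \<Delta>) n"
  shows "represents Q (m * n)"
proof -
  obtain a b c where Q: "Q = (a, b, c)" by (metis prod_cases3)
  have "trivial_product (a, - b, c) (principal_form \<Delta>) (a, b, c)"
    using trivial_product_rotate forms_inverse_product assms(1,2) unfolding Q by blast
  thus ?thesis using trivial_product_represents assms(3,4) represents_inverse unfolding Q by blast
qed

text \<open>The root \<open>E\<close> of a non-principal \<open>Q\<close> is one of the listed forms, say the \<open>j\<close>-th, and contributes
  \<open>a\<^sub>j c\<^sub>j\<close> as the product of its two outer coefficients. All other factors are absorbed as values of
  the principal form.\<close>

lemma represents_pairing_product:
  assumes "\<Delta> < 0" "odd (class_number \<Delta>)" "inverse_pairing \<Delta> n a b c" "Q \<in> forms \<Delta>"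
  shows "represents Q (\<Prod>i=1..n. a i * c i)"
proof -
  have N: "forms \<Delta> - {principal_form \<Delta>} = (\<Union>i\<in>{1..n}. {(a i, b i, c i), (a i, - b i, c i)})"
    using assms(3) by (simp add: inverse_pairing_def)
  have P: "principal_form \<Delta> \<in> forms \<Delta>" using principal_in_forms assms by blast
  have one: "represents (principal_form \<Delta>) 1"
    using represents_outer_coefficients(1) unfolding principal_form_def by auto
  have pi: "represents (principal_form \<Delta>) (a i * c i)" if "i \<in> {1..n}" for i
  proof -
    have "(a i, b i, c i) \<in> forms \<Delta>" using N that by blast
    from trivial_product_represents[OF forms_inverse_product[OF assms(1) this]]
    show ?thesis using represents_outer_coefficients by blast
  qed
  have pI: "represents (principal_form \<Delta>) (\<Prod>i\<in>I. a i * c i)" if "I \<subseteq> {1..n}" for I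
  proof -
    have "finite I" using that finite_subset by blast
    thus ?thesis using that
    proof (induction I rule: finite_induct)
      case (insert i I)
      thus ?case
        using principal_represents_mult[OF assms(1) P, of "a i * c i"] pi by simp
    qed (use one in simp)
  qed
  show ?thesis
  proof (cases "Q = principal_form \<Delta>")
    case True
    thus ?thesis using pI by simp
  next
    case False
    obtain E where E: "E \<in> forms \<Delta>" "trivial_product E E Q"
      using exists_square_root assms by blast
    have "E \<noteq> principal_form \<Delta>"
      using forms_square_unique[OF assms(1) P assms(4) P] E(2) False
        principal_form_square[OF assms(1) P] by blast
    hence "E \<in> (\<Union>i\<in>{1..n}. {(a i, b i, c i), (a i, - b i, c i)})" using E N by blast
    then obtain j where j: "j \<in> {1..n}" "E = (a j, b j, c j) \<or> E = (a j, - b j, c j)" by blast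
    hence "represents E (a j)" "represents E (c j)" using represents_outer_coefficients by blast+
    hence "represents Q (a j * c j)" using trivial_product_represents E(2) by blast
    hence "represents Q (a j * c j * (\<Prod>i\<in>{1..n} - {j}. a i * c i))"
      using principal_represents_mult[OF assms(1,4)] pI by blast
    thus ?thesis using prod.remove[OF finite_atLeastAtMost j(1), of "\<lambda>i. a i * c i"] by simp
  qed
qed

theorem theorem4:
  fixes \<Delta> :: int
  assumes "\<Delta> < 0"
    and "odd (class_number \<Delta>)"
  shows "infinite {m :: int. m > 0 \<and> (\<forall>Q \<in> forms \<Delta>. represents Q m)}
    \<and> (\<exists>n a b c. inverse_pairing \<Delta> n a b c)
    \<and> (\<forall>n a b c. inverse_pairing \<Delta> n a b c \<longrightarrow>
         (\<forall>Q \<in> forms \<Delta>. represents Q (\<Prod>i=1..n. a i * c i)))"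
proof (intro conjI allI impI ballI)
  show ex: "\<exists>n a b c. inverse_pairing \<Delta> n a b c" using exists_inverse_pairing assms .
  show "represents Q (\<Prod>i=1..n. a i * c i)"
    if "inverse_pairing \<Delta> n a b c" "Q \<in> forms \<Delta>" for n a b c Q
    using represents_pairing_product assms that .
  obtain n a b c where pair: "inverse_pairing \<Delta> n a b c" using ex by blast
  define M where "M = (\<Prod>i=1..n. a i * c i)"
  have "a i * c i > 0" if "i \<in> {1..n}" for i
  proof -
    have Q: "(a i, b i, c i) \<in> forms \<Delta>" using pair that unfolding inverse_pairing_def by blast
    hence "a i > 0" using forms_admissible(1)[OF assms(1)] admissible_leading_pos by blast
    moreover have "a i \<le> c i" using Q by (simp add: forms_def)
    ultimately show ?thesis by simp
  qed
  hence M: "M > 0" unfolding M_def by (intro prod_pos) auto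
  (* scaling the arguments by k + 1 multiplies a value by (k + 1)^2 *)
  define S where "S = range (\<lambda>k::nat. M * (int k + 1)\<^sup>2)"
  have "inj (\<lambda>k::nat. M * (int k + 1)\<^sup>2)"
    using M by (intro injI) (simp add: power2_eq_iff_nonneg)
  hence "infinite S" unfolding S_def by (simp add: finite_image_iff)
  moreover have "S \<subseteq> {m. m > 0 \<and> (\<forall>Q \<in> forms \<Delta>. represents Q m)}"
  proof
    fix m assume "m \<in> S"
    then obtain k :: nat where m: "m = M * (int k + 1)\<^sup>2" unfolding S_def by blast
    have "represents Q m" if Q: "Q \<in> forms \<Delta>" for Q
    proof -
      obtain a' b' c' where Q': "Q = (a', b', c')" by (metis prod_cases3)
      have "represents Q M" using represents_pairing_product[OF assms pair Q] by (simp add: M_def)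
      then obtain x y where "form_val Q x y = M" unfolding represents_def by blast
      hence "form_val Q ((int k + 1) * x) ((int k + 1) * y) = m"
        unfolding m Q' by (auto simp: power2_eq_square algebra_simps)
      thus ?thesis unfolding represents_def by blast
    qed
    moreover have "m > 0" using M by (simp add: m)
    ultimately show "m \<in> {m. m > 0 \<and> (\<forall>Q \<in> forms \<Delta>. represents Q m)}" by blast
  qed
  ultimately show "infinite {m. m > 0 \<and> (\<forall>Q \<in> forms \<Delta>. represents Q m)}"
    using finite_subset by blast
qed

end
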